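(* Let $A$ be a finite alphabet. For all sentences $I,J$ over $A$, the product of two fundamental coloured quasi-symmetric functions in $\mathrm{QSym}_A$ is $$F_I\cdot F_J=\sum_K F_K,$$ where the sum is over the sentences $K$ that are summands (counted with multiplicity) of the fundamental shuffle $I\star_F J$.
   Context: $\Bbbk$ is a field of characteristic zero. A sentence $I=(w_1,\dots,w_m)$ over $A$ is a finite sequence of non-empty words in letters of $A$; $1$ is the empty sentence; its maximal word is $w(I)=w_1w_2\cdots w_m$. Write $J\preccurlyeq I$ ($J$ refines $I$) if the words of $I$ can be obtained by concatenating adjacent words of $J$. $\mathrm{QSym}_A$ is the Hopf algebra over $\Bbbk$ with linear basis $(M_I)$ indexed by sentences over $A$, where $M_IM_J=\sum_K M_K$ with $K$ running over the summands (with multiplicity) of the quasi-shuffle $I*J$. The quasi-shuffle is defined recursively by $I*1=1*I=I$ and $((u)\cdot I)*((v)\cdot J)=(u)\cdot(I*((v)\cdot J))+(v)\cdot(((u)\cdot I)*J)+(uv)\cdot(I*J)$ for non-empty words $u,v$, where $\cdot$ is concatenation of sentences. The fundamental functions are $F_I=\sum_{J\preccurlyeq I}M_J$. Fundamental shuffle $I\star_F J$: (1) take the ordinary shuffle of the letters of the maximal words $w(I)$ and $w(J)$, i.e. the formal sum of all $\binom{|w(I)|+|w(J)|}{|w(I)|}$ interleavings (counted with multiplicity, remembering from which word of which sentence each letter comes), each viewed as a sentence of one-letter words; (2) in each summand concatenate neighbouring letters coming from the same word of $I$, and neighbouring letters coming from the same word of $J$; (3) then concatenate pairs of neighbouring subwords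 consisting of a subword of a word of $I$ followed by a subword of a word of $J$ (in this order). Equivalently, in an interleaving $c_1c_2\cdots c_n$ there is no word separation between $c_p$ and $c_{p+1}$ exactly when both come from the same word of $I$, or both come from the same word of $J$, or $c_p$ comes from $I$ and $c_{p+1}$ comes from $J$. For example, $(ab)\star_F(c,d)=(abc,d)+(ac,bd)+(ac,d,b)+(c,abd)+(c,ad,b)+(c,d,ab)$. *)

theory Defs
  imports "HOL-Library.Poly_Mapping" "HOL-Library.Multiset"
begin

type_synonym 'a word = "'a list"
type_synonym 'a sentence = "'a word list"

definition sentences :: "'a set \<Rightarrow> 'a sentence set" where
  "sentences A = {I. \<forall>w \<in> set I. w \<noteq> [] \<and> set w \<subseteq> A}"

text \<open>The words of \<open>I\<close> are the concatenations of the consecutive blocks of \<open>J\<close> listed in \<open>Bs\<close>.\<close>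
definition refines :: "'a sentence \<Rightarrow> 'a sentence \<Rightarrow> bool" (infix "\<preceq>\<^sub>r" 50) where
  "J \<preceq>\<^sub>r I \<longleftrightarrow> (\<exists>Bs. (\<forall>B \<in> set Bs. B \<noteq> []) \<and> concat Bs = J \<and> map concat Bs = I)"

fun quasi_shuffle :: "'a sentence \<Rightarrow> 'a sentence \<Rightarrow> 'a sentence multiset" where
  "quasi_shuffle I [] = {#I#}"
| "quasi_shuffle [] J = {#J#}"
| "quasi_shuffle (u # I) (v # J) =
     image_mset ((#) u) (quasi_shuffle I (v # J))
   + image_mset ((#) v) (quasi_shuffle (u # I) J)
   + image_mset ((#) (u @ v)) (quasi_shuffle I J)"


section \<open>The algebra of coloured quasi-symmetric functions\<close>

text \<open>
  Elements are the finitely supported coefficient functions with respect to the basis \<open>M\<^sub>I\<close>.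
  The ambient type also has basis elements indexed by lists of words that contain the empty
  word or letters outside of \<open>A\<close>; \<open>QSym A\<close> is the subspace spanned by the sentences over \<open>A\<close>,
  and it is closed under the product (\<open>QSym_mult_closed\<close> below).
\<close>

definition QSym :: "'a set \<Rightarrow> ('a sentence \<Rightarrow>\<^sub>0 'k::field_char_0) set" where
  "QSym A = {f. Poly_Mapping.keys f \<subseteq> sentences A}"

definition M :: "'a sentence \<Rightarrow> ('a sentence \<Rightarrow>\<^sub>0 'k::field_char_0)" where
  "M I = Poly_Mapping.single I 1"

text \<open>The bilinear extension of \<open>M\<^sub>I M\<^sub>J = \<Sum>\<^sub>K M\<^sub>K\<close>, \<open>K\<close> in the quasi-shuffle of \<open>I\<close> and \<open>J\<close>
  (see \<open>M_mult_M\<close> below).\<close>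
definition qsym_mult ::
  "('a sentence \<Rightarrow>\<^sub>0 'k) \<Rightarrow> ('a sentence \<Rightarrow>\<^sub>0 'k) \<Rightarrow> ('a sentence \<Rightarrow>\<^sub>0 'k::field_char_0)"
  (infixl "\<odot>" 70) where
  "f \<odot> g = (\<Sum>I \<in> Poly_Mapping.keys f. \<Sum>J \<in> Poly_Mapping.keys g. \<Sum>K \<in># quasi_shuffle I J.
      Poly_Mapping.single K (Poly_Mapping.lookup f I * Poly_Mapping.lookup g J))"

text \<open>Here \<open>J\<close> has to be restricted to sentences, since \<open>\<preceq>\<^sub>r\<close> alone would allow \<open>J\<close> to contain
  empty words. The letters of such a \<open>J\<close> are letters of \<open>I\<close>, so that the index set is finite
  (\<open>finite_refinements\<close>) and does not depend on the alphabet (\<open>refinement_in_sentences\<close>).\<close>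
definition F :: "'a sentence \<Rightarrow> ('a sentence \<Rightarrow>\<^sub>0 'k::field_char_0)" where
  "F I = (\<Sum>J \<in> {J \<in> sentences UNIV. J \<preceq>\<^sub>r I}. M J)"


section \<open>The fundamental shuffle\<close>

text \<open>The letters of the maximal word of \<open>I\<close>, each with the index of the word of \<open>I\<close> it comes from.\<close>
definition indexed_letters :: "'a sentence \<Rightarrow> (nat \<times> 'a) list" where
  "indexed_letters I = concat (map (\<lambda>i. map (Pair i) (I ! i)) [0..<length I])"

text \<open>Letters of the first sentence are marked by \<open>Inl\<close>, those of the second one by \<open>Inr\<close>.
  The relation says that there is no word separation between two neighbouring letters.\<close>
fun joined :: "(nat \<times> 'a) + (nat \<times> 'a) \<Rightarrow> (nat \<times> 'a) + (nat \<times> 'a) \<Rightarrow> bool" where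
  "joined (Inl (i, a)) (Inl (j, b)) \<longleftrightarrow> i = j"
| "joined (Inr (i, a)) (Inr (j, b)) \<longleftrightarrow> i = j"
| "joined (Inl (i, a)) (Inr (j, b)) \<longleftrightarrow> True"
| "joined (Inr (i, a)) (Inl (j, b)) \<longleftrightarrow> False"

fun letter :: "(nat \<times> 'a) + (nat \<times> 'a) \<Rightarrow> 'a" where
  "letter (Inl (i, a)) = a"
| "letter (Inr (i, a)) = a"

text \<open>Cut a list between neighbours \<open>x\<close>, \<open>y\<close> exactly when \<open>\<not> R x y\<close>.\<close>
fun split_runs :: "('b \<Rightarrow> 'b \<Rightarrow> bool) \<Rightarrow> 'b list \<Rightarrow> 'b list list" where
  "split_runs R [] = []"
| "split_runs R [x] = [[x]]"
| "split_runs R (x # y # zs) =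
     (if R x y then (x # hd (split_runs R (y # zs))) # tl (split_runs R (y # zs))
      else [x] # split_runs R (y # zs))"

text \<open>Because of the marks \<open>Inl\<close> and \<open>Inr\<close> different interleavings are different lists, so the
  set \<open>shuffles\<close> contains each interleaving exactly once (\<open>card_interleavings\<close>); equal sentences
  obtained from different interleavings are then counted with multiplicity by \<open>image_mset\<close>.\<close>
definition interleavings :: "'a sentence \<Rightarrow> 'a sentence \<Rightarrow> ((nat \<times> 'a) + (nat \<times> 'a)) list set" where
  "interleavings I J = shuffles (map Inl (indexed_letters I)) (map Inr (indexed_letters J))"

definition fundamental_shuffle :: "'a sentence \<Rightarrow> 'a sentence \<Rightarrow> 'a sentence multiset"
  (infix "\<star>\<^sub>F" 65) where
  "I \<star>\<^sub>F J = image_mset (\<lambda>c. map (map letter) (split_runs joined c)) (mset_set (interleavings I J))"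


section \<open>Basic facts\<close>

lemma refinement_in_sentences:
  assumes "I \<in> sentences A" "J \<in> sentences UNIV" "J \<preceq>\<^sub>r I"
  shows "J \<in> sentences A"
proof -
  obtain Bs where Bs: "concat Bs = J" "map concat Bs = I"
    using assms(3) by (auto simp: refines_def)
  have "set w \<subseteq> A" if "w \<in> set J" for w
  proof -
    obtain B where B: "B \<in> set Bs" "w \<in> set B"
      using \<open>w \<in> set J\<close> unfolding Bs(1)[symmetric] by auto
    then have "concat B \<in> set I"
      unfolding Bs(2)[symmetric] by simp
    then have "set (concat B) \<subseteq> A"
      using assms(1) unfolding sentences_def by blast
    then show ?thesis
      using B by auto
  qed
  then show ?thesis
    using assms(2) by (auto simp: sentences_def)
qed

lemma finite_refinements: "finite {J \<in> sentences UNIV. J \<preceq>\<^sub>r I}"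
proof (rule finite_subset)
  let ?n = "length (concat I)"
  let ?W = "{w. set w \<subseteq> set (concat I) \<and> length w \<le> ?n}"
  have len: "length J \<le> length (concat J)" if "J \<in> sentences UNIV" for J :: "'a sentence"
    using that
  proof (induction J)
    case (Cons w J)
    then show ?case by (cases w) (auto simp: sentences_def)
  qed simp
  have word_len: "length w \<le> length (concat J)" if "w \<in> set J" for w and J :: "'a sentence"
    using that by (induction J) auto
  have concat_concat: "concat (map concat Bs) = concat (concat Bs)" for Bs :: "'a sentence list"
    by (induction Bs) auto
  show "{J \<in> sentences UNIV. J \<preceq>\<^sub>r I} \<subseteq> {J. set J \<subseteq> ?W \<and> length J \<le> ?n}"
  proof
    fix J
    assume J: "J \<in> {J \<in> sentences UNIV. J \<preceq>\<^sub>r I}"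
    then have eq: "concat I = concat J"
      by (auto simp: refines_def concat_concat)
    have "length J \<le> ?n"
      unfolding eq using J len by blast
    moreover have "w \<in> ?W" if "w \<in> set J" for w
      unfolding eq using that word_len[OF that] by auto
    ultimately show "J \<in> {J. set J \<subseteq> ?W \<and> length J \<le> ?n}"
      by blast
  qed
  show "finite {J. set J \<subseteq> ?W \<and> length J \<le> ?n}"
    by (intro finite_lists_length_le) simp
qed

lemma M_in_QSym: "I \<in> sentences A \<Longrightarrow> M I \<in> QSym A"
  by (simp add: M_def QSym_def)

lemma QSym_sum_closed: "(\<And>x. x \<in> X \<Longrightarrow> f x \<in> QSym A) \<Longrightarrow> sum f X \<in> QSym A"
  unfolding QSym_def mem_Collect_eq by (rule order_trans[OF keys_sum]) blast

lemma F_in_QSym: "I \<in> sentences A \<Longrightarrow> F I \<in> QSym A"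
  unfolding F_def by (rule QSym_sum_closed, rule M_in_QSym) (blast intro: refinement_in_sentences)

lemma M_mult_M: "M I \<odot> M J = (\<Sum>K \<in># quasi_shuffle I J. M K)"
  by (simp add: M_def qsym_mult_def)

lemma quasi_shuffle_in_sentences:
  "I \<in> sentences A \<Longrightarrow> J \<in> sentences A \<Longrightarrow> K \<in># quasi_shuffle I J \<Longrightarrow> K \<in> sentences A"
proof (induction I J arbitrary: K rule: quasi_shuffle.induct)
  case (3 u I v J)
  have Cons_iff: "w # K \<in> sentences A \<longleftrightarrow> w \<noteq> [] \<and> set w \<subseteq> A \<and> K \<in> sentences A" for w K
    by (auto simp: sentences_def)
  from "3.prems"(3) consider
      K' where "K = u # K'" "K' \<in># quasi_shuffle I (v # J)"
    | K' where "K = v # K'" "K' \<in># quasi_shuffle (u # I) J"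
    | K' where "K = (u @ v) # K'" "K' \<in># quasi_shuffle I J"
    by auto
  then show ?case
  proof cases
    case 1
    have "K' \<in> sentences A"
      using "3.prems"(1,2) by (intro "3.IH"(1)[OF _ _ 1(2)]) (simp_all add: Cons_iff)
    then show ?thesis
      using 1(1) "3.prems"(1) by (simp add: Cons_iff)
  next
    case 2
    have "K' \<in> sentences A"
      using "3.prems"(1,2) by (intro "3.IH"(2)[OF _ _ 2(2)]) (simp_all add: Cons_iff)
    then show ?thesis
      using 2(1) "3.prems"(2) by (simp add: Cons_iff)
  next
    case 3
    have "K' \<in> sentences A"
      using "3.prems"(1,2) by (intro "3.IH"(3)[OF _ _ 3(2)]) (simp_all add: Cons_iff)
    then show ?thesis
      using 3(1) "3.prems"(1,2) by (simp add: Cons_iff)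
  qed
qed simp_all

lemma QSym_mult_closed:
  fixes f g :: "'a sentence \<Rightarrow>\<^sub>0 'b::field_char_0"
  assumes "f \<in> QSym A" "g \<in> QSym A"
  shows "f \<odot> g \<in> QSym A"
proof -
  have add_closed: "f + g \<in> QSym A" if "f \<in> QSym A" "g \<in> QSym A"
    for f g :: "'a sentence \<Rightarrow>\<^sub>0 'b"
    using that keys_add[of f g] unfolding QSym_def by blast
  have sum_mset_closed: "(\<forall>K. K \<in># N \<longrightarrow> h K \<in> QSym A) \<Longrightarrow> (\<Sum>K \<in># N. h K) \<in> QSym A"
    for N :: "'a sentence multiset" and h :: "'a sentence \<Rightarrow> ('a sentence \<Rightarrow>\<^sub>0 'b)"
    by (induction N) (simp_all add: add_closed, simp add: QSym_def)
  show ?thesis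
    unfolding qsym_mult_def
  proof (intro QSym_sum_closed sum_mset_closed allI impI)
    fix I J K
    assume "I \<in> Poly_Mapping.keys f" "J \<in> Poly_Mapping.keys g" "K \<in># quasi_shuffle I J"
    then have "K \<in> sentences A"
      using assms unfolding QSym_def by (blast intro: quasi_shuffle_in_sentences)
    then show "Poly_Mapping.single K (Poly_Mapping.lookup f I * Poly_Mapping.lookup g J) \<in> QSym A"
      by (simp add: QSym_def)
  qed
qed

lemma length_indexed_letters: "length (indexed_letters I) = length (concat I)"
proof -
  have "map (\<lambda>i. length (I ! i)) [0..<length I] = map length I"
    by (rule nth_equalityI) auto
  then show ?thesis
    by (simp add: indexed_letters_def length_concat comp_def)
qed

lemma card_interleavings:
  "card (interleavings I J) =
     (length (concat I) + length (concat J)) choose length (concat I)"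
  unfolding interleavings_def
  by (subst card_disjoint_shuffles) (auto simp: length_indexed_letters)

lemma fundamental_shuffle_example:
  "[[a, b]] \<star>\<^sub>F [[c], [d]] =
     {# [[a,b,c],[d]], [[a,c],[b,d]], [[a,c],[d],[b]], [[c],[a,b,d]], [[c],[a,d],[b]], [[c],[d],[a,b]] #}"
  by (simp add: fundamental_shuffle_def interleavings_def indexed_letters_def image_Un)

end

theory Submission
  imports Defs
begin

text \<open>
  Keep the marks of the letters, so that nothing is counted with multiplicity. The refinements of
  the sentence cut out of an interleaving \<open>c\<close> are then the factorizations of \<open>c\<close> into words all of
  whose neighbours are joined, and both sides of the theorem become sums of \<open>M\<^sub>K\<close> over sets of marked
  sentences \<open>K\<close>. A word has only joined neighbours iff it consists of a run of the first kind
  followed by a run of the second kind. Deleting the letters of one kind from \<open>K\<close> therefore gives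
  refinements \<open>P\<close> of \<open>I\<close> and \<open>Q\<close> of \<open>J\<close>, and the \<open>K\<close> lying over a given pair \<open>(P, Q)\<close> are exactly
  the terms of the quasi-shuffle of \<open>P\<close> and \<open>Q\<close>.
\<close>

section \<open>Maximal runs and factorizations into chains\<close>

definition chain_factorizations :: "('b \<Rightarrow> 'b \<Rightarrow> bool) \<Rightarrow> 'b list \<Rightarrow> 'b list list set" where
  "chain_factorizations R c = {K. concat K = c \<and> (\<forall>w \<in> set K. w \<noteq> [] \<and> successively R w)}"

lemma concat_map_concat: "concat (map concat Bs) = concat (concat Bs)"
  by (induction Bs) auto

lemma concat_split_runs: "concat (split_runs R c) = c"
proof (induction R c rule: split_runs.induct)
  case (3 R x y zs)
  then show ?case
    by (cases "split_runs R (y # zs)") auto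
qed auto

lemma split_runs_eq_Nil_iff: "split_runs R c = [] \<longleftrightarrow> c = []"
  by (induction R c rule: split_runs.induct) auto

text \<open>No cut falls inside a chain, so only the junction of \<open>last w\<close> and
  \<open>hd c\<close> decides whether \<open>w\<close> is absorbed by the first run of
  \<open>c\<close> or stays a run of its own. The guard \<open>c \<noteq> []\<close> keeps the
  unspecified \<open>hd []\<close> out.\<close>

lemma split_runs_append:
  assumes "w \<noteq> []" "successively R w"
  shows "split_runs R (w @ c) =
    (if c \<noteq> [] \<and> R (last w) (hd c) then (w @ hd (split_runs R c)) # tl (split_runs R c)
     else w # split_runs R c)"
  using assms
proof (induction w rule: induct_list012)
  case (2 x)
  then show ?case by (cases c) auto
qed auto

text \<open>Each junction of two words forces the second alternative of
  \<open>split_runs_append\<close>. This identifies a given list of words as the runs of its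
  concatenation.\<close>

lemma split_runs_concat:
  assumes "\<forall>w \<in> set Ws. w \<noteq> [] \<and> successively R w"
    and "successively (\<lambda>u v. \<not> R (last u) (hd v)) Ws"
  shows "split_runs R (concat Ws) = Ws"
  using assms
proof (induction Ws rule: induct_list012)
  case (3 u v Ws)
  then show ?case
    using split_runs_append[of u R "concat (v # Ws)"] by auto
qed (use split_runs_append[of _ R "[]"] in auto)

lemma split_runs_chains: "w \<in> set (split_runs R c) \<Longrightarrow> w \<noteq> [] \<and> successively R w"
proof (induction R c arbitrary: w rule: split_runs.induct)
  case (3 R x y zs)
  have IH: "v \<in> set (split_runs R (y # zs)) \<Longrightarrow> v \<noteq> [] \<and> successively R v" for v
    using "3.IH" by (cases "R x y") blast+
  show ?case
  proof (cases "split_runs R (y # zs)")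
    case Nil
    then show ?thesis by (simp add: split_runs_eq_Nil_iff)
  next
    case (Cons u us)
    then have "u \<noteq> []" "successively R u"
      using IH[of u] by auto
    \<comment> \<open>The runs concatenate to \<open>y # zs\<close>, so the first one starts with
      \<open>y\<close>; hence \<open>R x y\<close> is what is needed to put \<open>x\<close> in
      front of it.\<close>
    moreover from this have "hd u = y"
      using concat_split_runs[of R "y # zs"] Cons by (cases u) auto
    ultimately show ?thesis
      using "3.prems" IH[of w] Cons by (cases "R x y") (auto simp: successively_Cons)
  qed
qed auto

text \<open>A word of a refinement is a factor of a single run, hence a chain. Conversely a chain
  crosses no cut, so it lies within one run, and the words within the same run form a block.\<close>

lemma refines_split_runs_iff:
  "{K. K \<preceq>\<^sub>r split_runs R c \<and> [] \<notin> set K} = chain_factorizations R c"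
proof (intro set_eqI iffI)
  fix K
  assume "K \<in> {K. K \<preceq>\<^sub>r split_runs R c \<and> [] \<notin> set K}"
  then obtain Bs where Bs: "concat Bs = K" "map concat Bs = split_runs R c" and K: "[] \<notin> set K"
    by (auto simp: refines_def)
  have "concat K = c"
    using Bs concat_split_runs[of R c] concat_map_concat[of Bs] by simp
  moreover have "successively R w" if "w \<in> set K" for w
  proof -
    obtain B where B: "B \<in> set Bs" "w \<in> set B"
      using \<open>w \<in> set K\<close> Bs(1) by auto
    then have "concat B \<in> set (split_runs R c)"
      using Bs(2)[symmetric] by simp
    then have "successively R (concat B)"
      using split_runs_chains by blast
    moreover obtain B1 B2 where "B = B1 @ w # B2"
      using B(2) by (meson split_list)
    ultimately show ?thesis
      by (simp add: successively_append_iff)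
  qed
  ultimately show "K \<in> chain_factorizations R c"
    using K by (auto simp: chain_factorizations_def)
next
  fix K
  assume K: "K \<in> chain_factorizations R c"
  have "K \<preceq>\<^sub>r split_runs R (concat K)"
    if "\<forall>w \<in> set K. w \<noteq> [] \<and> successively R w"
    using that
  proof (induction K)
    case Nil
    then show ?case by (auto simp: refines_def)
  next
    case (Cons w K)
    then obtain Bs where Bs: "\<forall>B \<in> set Bs. B \<noteq> []" "concat Bs = K"
        "map concat Bs = split_runs R (concat K)"
      by (auto simp: refines_def)
    have split: "split_runs R (w @ concat K) =
      (if concat K \<noteq> [] \<and> R (last w) (hd (concat K))
       then (w @ hd (split_runs R (concat K))) # tl (split_runs R (concat K))
       else w # split_runs R (concat K))"
      using Cons.prems by (intro split_runs_append) auto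
    show ?case
    proof (cases "concat K \<noteq> [] \<and> R (last w) (hd (concat K))")
      \<comment> \<open>The first run of the tail absorbs \<open>w\<close>, so \<open>w\<close>
        enters the first block; in the other case it opens a new block \<open>[w]\<close>.\<close>
      case True
      then have "Bs \<noteq> []"
        using Bs(3) split_runs_eq_Nil_iff[of R "concat K"] by fastforce
      then obtain B Bs' where "Bs = B # Bs'"
        by (cases Bs) auto
      then show ?thesis
        using Bs True split unfolding refines_def
        by (intro exI[of _ "(w # B) # Bs'"]) (simp flip: Bs(3))
    next
      case False
      then have "split_runs R (w @ concat K) = w # split_runs R (concat K)"
        using split by (simp only: if_False)
      then show ?thesis
        using Bs unfolding refines_def
        by (intro exI[of _ "[w] # Bs"]) simp
    qed
  qed
  then show "K \<in> {K. K \<preceq>\<^sub>r split_runs R c \<and> [] \<notin> set K}"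
    using K by (auto simp: chain_factorizations_def)
qed

section \<open>Forgetting the marks\<close>

lemma concat_eq_map_imp_lift:
  "concat B = map f s \<Longrightarrow> \<exists>B'. concat B' = s \<and> map (map f) B' = B"
proof (induction B arbitrary: s)
  case (Cons w B)
  then obtain s1 s2 where s: "s = s1 @ s2" "w = map f s1" "concat B = map f s2"
    by (auto simp: append_eq_map_conv)
  then obtain B' where "concat B' = s2" "map (map f) B' = B"
    using Cons.IH by blast
  then show ?case
    using s by (intro exI[of _ "s1 # B'"]) simp
qed auto

text \<open>Refining only places cuts between letters, so the cuts made in the relabelled words can
  be made at the same positions in \<open>S\<close>.\<close>

lemma refines_map_iff:
  "J \<preceq>\<^sub>r map (map f) S \<longleftrightarrow> (\<exists>K. K \<preceq>\<^sub>r S \<and> J = map (map f) K)"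
proof
  assume "J \<preceq>\<^sub>r map (map f) S"
  then obtain Bs where "\<forall>B \<in> set Bs. B \<noteq> []" "concat Bs = J" "map concat Bs = map (map f) S"
    by (auto simp: refines_def)
  then show "\<exists>K. K \<preceq>\<^sub>r S \<and> J = map (map f) K"
  proof (induction S arbitrary: Bs J)
    case Nil
    then show ?case by (auto simp: refines_def)
  next
    case (Cons s S)
    then obtain B Bs' where Bs: "Bs = B # Bs'" "concat B = map f s" "map concat Bs' = map (map f) S"
      by auto
    then obtain K' where K': "K' \<preceq>\<^sub>r S" "concat Bs' = map (map f) K'"
      using Cons.IH[of Bs' "concat Bs'"] Cons.prems by auto
    then obtain Cs where Cs: "\<forall>B \<in> set Cs. B \<noteq> []" "concat Cs = K'" "map concat Cs = S"
      by (auto simp: refines_def)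
    obtain B' where B': "concat B' = s" "map (map f) B' = B"
      using concat_eq_map_imp_lift[OF Bs(2)] by blast
    have "B' @ K' \<preceq>\<^sub>r s # S"
      unfolding refines_def using B' Cs Cons.prems Bs
      by (intro exI[of _ "B' # Cs"]) auto
    moreover have "J = map (map f) (B' @ K')"
      using Cons.prems Bs(1) B' K' by auto
    ultimately show ?case by blast
  qed
next
  assume "\<exists>K. K \<preceq>\<^sub>r S \<and> J = map (map f) K"
  then obtain Bs where "\<forall>B \<in> set Bs. B \<noteq> []" "J = map (map f) (concat Bs)" "map concat Bs = S"
    by (auto simp: refines_def)
  then show "J \<preceq>\<^sub>r map (map f) S"
    unfolding refines_def
    by (intro exI[of _ "map (map (map f)) Bs"]) (auto simp: map_concat)
qed

text \<open>The map \<open>f\<close> may identify letters, as \<open>letter\<close> does, but the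
  image keeps the lengths of the words, and these together with the concatenation \<open>c\<close>
  determine \<open>K\<close>.\<close>

lemma inj_on_map_map_concat: "inj_on (map (map f)) {K. concat K = c}"
proof (rule inj_onI)
  fix K L
  assume KL: "K \<in> {K. concat K = c}" "L \<in> {K. concat K = c}" "map (map f) K = map (map f) L"
  have "map length K = map length L"
    using arg_cong[OF KL(3), of "map length"] by (simp add: comp_def)
  then have "length K = length L" "\<forall>(x, y) \<in> set (zip K L). length x = length y"
    by (auto simp: list_eq_iff_nth_eq in_set_zip dest: map_eq_imp_length_eq)
  then show "K = L"
    using KL by (intro concat_injective) auto
qed

text \<open>Lets sums over refinements of an unmarked sentence be taken over marked factorizations.
  Surjectivity is the lifting of refinements; injectivity comes from the fixed
  concatenation.\<close>

lemma bij_betw_chain_factorizations_refinements: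
  "bij_betw (map (map f)) (chain_factorizations R c)
     {J \<in> sentences UNIV. J \<preceq>\<^sub>r map (map f) (split_runs R c)}"
proof -
  have "map (map f) ` {K. K \<preceq>\<^sub>r S \<and> [] \<notin> set K} = {J \<in> sentences UNIV. J \<preceq>\<^sub>r map (map f) S}" for S
    by (fastforce simp: refines_map_iff sentences_def)
  moreover have "inj_on (map (map f)) (chain_factorizations R c)"
    by (rule inj_on_subset[OF inj_on_map_map_concat[of f c]]) (auto simp: chain_factorizations_def)
  ultimately show ?thesis
    by (simp add: bij_betw_def flip: refines_split_runs_iff)
qed

lemma finite_chain_factorizations: "finite (chain_factorizations R c)"
  using bij_betw_finite[OF bij_betw_chain_factorizations_refinements] finite_refinements by blast

section \<open>Fundamental functions and their products in the basis \<open>M\<close>\<close>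

lemma F_split_runs:
  "F (map (map f) (split_runs R c)) = (\<Sum>K \<in> chain_factorizations R c. M (map (map f) K))"
  unfolding F_def
  by (rule sum.reindex_bij_betw[OF bij_betw_chain_factorizations_refinements, symmetric])

lemma lookup_F:
  "Poly_Mapping.lookup (F I :: 'a sentence \<Rightarrow>\<^sub>0 'k::field_char_0) K =
     (if K \<in> sentences UNIV \<and> K \<preceq>\<^sub>r I then 1 else 0)"
  using finite_refinements[of I]
  by (simp add: F_def M_def lookup_sum lookup_single when_def)

text \<open>The product runs over the supports of its factors; the support of a fundamental function
  is its set of refinements, all with coefficient 1.\<close>

lemma F_mult_F:
  "(F I :: 'a sentence \<Rightarrow>\<^sub>0 'k::field_char_0) \<odot> F J =
     (\<Sum>P \<in> {P \<in> sentences UNIV. P \<preceq>\<^sub>r I}. \<Sum>Q \<in> {Q \<in> sentences UNIV. Q \<preceq>\<^sub>r J}.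
        \<Sum>K \<in># quasi_shuffle P Q. M K)"
proof -
  have keys: "Poly_Mapping.keys (F S :: 'a sentence \<Rightarrow>\<^sub>0 'k) = {P \<in> sentences UNIV. P \<preceq>\<^sub>r S}" for S
    by (auto simp: in_keys_iff lookup_F split: if_splits)
  show ?thesis
    unfolding qsym_mult_def keys by (intro sum.cong refl) (simp add: lookup_F M_def)
qed

section \<open>Quasi-shuffles of marked sentences\<close>

lemma quasi_shuffle_map:
  "quasi_shuffle (map (map f) P) (map (map f) Q) = image_mset (map (map f)) (quasi_shuffle P Q)"
  by (induction P Q rule: quasi_shuffle.induct) (simp_all add: multiset.map_comp comp_def)

text \<open>Restriction to one kind of letters. A word consisting only of the other kind leaves an
  empty word, which is dropped so that the result has only non-empty words.\<close>

definition parts :: "('b \<Rightarrow> bool) \<Rightarrow> 'b list list \<Rightarrow> 'b list list" where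
  "parts p K = filter (\<lambda>w. w \<noteq> []) (map (filter p) K)"

lemma parts_simps [simp]:
  "parts p [] = []"
  "parts p (w # K) = (if filter p w = [] then parts p K else filter p w # parts p K)"
  by (simp_all add: parts_def)

lemma concat_parts: "concat (parts p K) = filter p (concat K)"
  by (induction K) auto

lemma set_parts: "set (parts p K) = filter p ` set K - {[]}"
  by (auto simp: parts_def)

definition left_first :: "('b \<Rightarrow> bool) \<Rightarrow> 'b list \<Rightarrow> bool" where
  "left_first p w \<longleftrightarrow> filter p w @ filter (\<lambda>a. \<not> p a) w = w"

text \<open>On marked words the terms of the quasi-shuffle are distinct, so it is determined by this set
  (\<open>quasi_shuffle_eq_mset_merges\<close>).\<close>
definition merges :: "('b \<Rightarrow> bool) \<Rightarrow> 'b list list \<Rightarrow> 'b list list \<Rightarrow> 'b list list set" where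
  "merges p P Q = {K. (\<forall>w \<in> set K. w \<noteq> [] \<and> left_first p w) \<and>
     parts p K = P \<and> parts (\<lambda>a. \<not> p a) K = Q}"

lemma filter_conv_if_all:
  "\<forall>a \<in> set u. p a \<Longrightarrow> filter p u = u"
  "\<forall>a \<in> set u. p a \<Longrightarrow> filter (\<lambda>a. \<not> p a) u = []"
  "\<forall>a \<in> set u. \<not> p a \<Longrightarrow> filter (\<lambda>a. \<not> p a) u = u"
  "\<forall>a \<in> set u. \<not> p a \<Longrightarrow> filter p u = []"
  by (auto simp: filter_empty_conv intro: filter_True)

lemma parts_eq_self:
  assumes "\<forall>u \<in> set P. u \<noteq> [] \<and> (\<forall>a \<in> set u. p a)"
  shows "parts p P = P" "parts (\<lambda>a. \<not> p a) P = []"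
  using assms by (induction P) (simp_all add: filter_conv_if_all(1,2))

lemma parts_eq_self_if_other_Nil:
  assumes "\<forall>w \<in> set K. w \<noteq> [] \<and> left_first p w"
  shows "parts (\<lambda>a. \<not> p a) K = [] \<Longrightarrow> parts p K = K"
    and "parts p K = [] \<Longrightarrow> parts (\<lambda>a. \<not> p a) K = K"
  using assms by (induction K) (auto simp: left_first_def split: if_splits)

lemma merges_Nil_right:
  assumes "\<forall>u \<in> set P. u \<noteq> [] \<and> (\<forall>a \<in> set u. p a)"
  shows "merges p P [] = {P}"
proof -
  have "\<forall>u \<in> set P. u \<noteq> [] \<and> left_first p u"
    using assms by (simp add: left_first_def filter_conv_if_all(1,2))
  then have "P \<in> merges p P []"
    using parts_eq_self[of P p, OF assms] by (simp add: merges_def)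
  moreover have "K = P" if "K \<in> merges p P []" for K
    using that parts_eq_self_if_other_Nil(1)[of K p] by (simp add: merges_def)
  ultimately show ?thesis
    by blast
qed

lemma merges_Nil_left:
  assumes "\<forall>v \<in> set Q. v \<noteq> [] \<and> (\<forall>a \<in> set v. \<not> p a)"
  shows "merges p [] Q = {Q}"
proof -
  have "\<forall>v \<in> set Q. v \<noteq> [] \<and> left_first p v"
    using assms by (simp add: left_first_def filter_conv_if_all(3,4))
  then have "Q \<in> merges p [] Q"
    using parts_eq_self[of Q "\<lambda>a. \<not> p a", OF assms] by (simp add: merges_def)
  moreover have "K = Q" if "K \<in> merges p [] Q" for K
    using that parts_eq_self_if_other_Nil(2)[of K p] by (simp add: merges_def)
  ultimately show ?thesis
    by blast
qed

text \<open>The first word of a merge splits as \<open>l @ r\<close> by kind. A non-empty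
  \<open>l\<close> must be \<open>u\<close>, a non-empty \<open>r\<close> must be \<open>v\<close>,
  and they are not both empty: this gives the three summands of the quasi-shuffle recursion.\<close>

lemma merges_Cons_Cons:
  assumes "u \<noteq> []" "\<forall>a \<in> set u. p a" "v \<noteq> []" "\<forall>a \<in> set v. \<not> p a"
  shows "merges p (u # P) (v # Q) =
    (#) u ` merges p P (v # Q) \<union> (#) v ` merges p (u # P) Q \<union> (#) (u @ v) ` merges p P Q"
    (is "?L = ?R")
proof
  note filters = filter_conv_if_all(1,2)[OF assms(2)] filter_conv_if_all(3,4)[OF assms(4)]
  have left_first: "left_first p u" "left_first p v" "left_first p (u @ v)"
    by (simp_all add: left_first_def filters)
  have "u # K \<in> ?L" if "K \<in> merges p P (v # Q)" for K
    using that by (simp add: merges_def left_first filters assms(1))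
  moreover have "v # K \<in> ?L" if "K \<in> merges p (u # P) Q" for K
    using that by (simp add: merges_def left_first filters assms(3))
  moreover have "(u @ v) # K \<in> ?L" if "K \<in> merges p P Q" for K
    using that by (simp add: merges_def left_first filters assms(1,3))
  ultimately show "?R \<subseteq> ?L"
    by blast
  show "?L \<subseteq> ?R"
  proof
    fix K
    assume K: "K \<in> ?L"
    then obtain w K' where w: "K = w # K'"
      by (cases K) (simp_all add: merges_def)
    obtain l r where lr: "filter p w = l" "filter (\<lambda>a. \<not> p a) w = r"
      by blast
    have "l @ r = w" "w \<noteq> []"
      using K lr by (simp_all add: merges_def w left_first_def)
    have K': "\<forall>w \<in> set K'. w \<noteq> [] \<and> left_first p w"
      and eqs: "(if l = [] then parts p K' else l # parts p K') = u # P"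
        "(if r = [] then parts (\<lambda>a. \<not> p a) K' else r # parts (\<lambda>a. \<not> p a) K') = v # Q"
      using K lr by (simp_all add: merges_def w split: if_splits)
    consider "l = []" "r \<noteq> []" | "l \<noteq> []" "r = []" | "l \<noteq> []" "r \<noteq> []"
      using \<open>l @ r = w\<close> \<open>w \<noteq> []\<close> by blast
    then show "K \<in> ?R"
    proof cases
      case 1
      then have "r = v" "K' \<in> merges p (u # P) Q"
        using K' eqs by (simp_all add: merges_def)
      then show ?thesis using 1 w \<open>l @ r = w\<close> by simp
    next
      case 2
      then have "l = u" "K' \<in> merges p P (v # Q)"
        using K' eqs by (simp_all add: merges_def)
      then show ?thesis using 2 w \<open>l @ r = w\<close> by simp
    next
      case 3
      then have "l = u" "r = v" "K' \<in> merges p P Q"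
        using K' eqs by (simp_all add: merges_def)
      then show ?thesis using \<open>l @ r = w\<close> w by simp
    qed
  qed
qed

text \<open>Induction along the quasi-shuffle recursion. The first words \<open>u\<close>,
  \<open>v\<close> and \<open>u @ v\<close> of its three summands are pairwise different, since
  \<open>u\<close> and \<open>v\<close> are non-empty and of different kinds; so the sum of
  multisets is a disjoint union.\<close>

lemma quasi_shuffle_eq_mset_merges:
  assumes "\<forall>u \<in> set P. u \<noteq> [] \<and> (\<forall>a \<in> set u. p a)"
    and "\<forall>v \<in> set Q. v \<noteq> [] \<and> (\<forall>a \<in> set v. \<not> p a)"
  shows "finite (merges p P Q) \<and> quasi_shuffle P Q = mset_set (merges p P Q)"
  using assms
proof (induction P Q rule: quasi_shuffle.induct)
  case (1 I)
  then show ?case by (simp add: merges_Nil_right)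
next
  case (2 v J)
  then show ?case using merges_Nil_left[of "v # J" p] by simp
next
  case (3 u I v J)
  have uv: "u \<noteq> []" "\<forall>a \<in> set u. p a" "v \<noteq> []" "\<forall>a \<in> set v. \<not> p a"
    using "3.prems" by auto
  then have "u \<noteq> v" "u @ v \<noteq> u" "u @ v \<noteq> v"
    by (cases u; cases v; auto)+
  then have disj: "(#) u ` X \<inter> (#) v ` Y = {}" "((#) u ` X \<union> (#) v ` Y) \<inter> (#) (u @ v) ` Z = {}"
    for X Y Z by auto
  show ?case
    unfolding merges_Cons_Cons[OF uv] using 3
    by (simp add: mset_set_Union disj flip: image_mset_mset_set)
qed

section \<open>Interleavings, joined letters and the double count\<close>

lemma mem_shuffles_iff_filter:
  assumes "\<forall>a \<in> set x. p a" "\<forall>a \<in> set y. \<not> p a"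
  shows "c \<in> shuffles x y \<longleftrightarrow> filter p c = x \<and> filter (\<lambda>a. \<not> p a) c = y"
proof
  assume c: "c \<in> shuffles x y"
  have "filter q c \<in> shuffles (filter q x) (filter q y)" for q
    using c filter_shuffles[of q x y] by blast
  \<comment> \<open>Each filter keeps one argument and empties the other, so the shuffle set on the
    right becomes a singleton.\<close>
  from this[of p] this[of "\<lambda>a. \<not> p a"]
  show "filter p c = x \<and> filter (\<lambda>a. \<not> p a) c = y"
    by (simp add: filter_conv_if_all assms)
qed (use partition_in_shuffles[of c p] in auto)

lemma joined_isl_cases:
  "isl a \<Longrightarrow> \<not> isl b \<Longrightarrow> joined a b" "\<not> isl a \<Longrightarrow> isl b \<Longrightarrow> \<not> joined a b"
  by (cases a; cases b; auto)+

lemma successively_joined_Cons_not_isl: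
  "successively joined (a # w) \<Longrightarrow> \<not> isl a \<Longrightarrow> \<forall>b \<in> set w. \<not> isl b"
proof (induction w arbitrary: a)
  case (Cons b w)
  then have "\<not> isl b"
    using joined_isl_cases(2)[of a b] by auto
  then show ?case
    using Cons.IH[of b] Cons.prems by simp
qed simp

text \<open>The asymmetry of \<open>joined\<close> enters here: from \<open>Inl\<close> to
  \<open>Inr\<close> is always joined, the reverse never, so a chain changes kind at most once. This
  matches the order in the term \<open>u @ v\<close> of the quasi-shuffle.\<close>

lemma successively_joined_iff:
  "successively joined w \<longleftrightarrow> left_first isl w \<and>
     successively joined (filter isl w) \<and> successively joined (filter (\<lambda>a. \<not> isl a) w)"
    (is "?S w \<longleftrightarrow> _")
proof -
  have decomp: "left_first isl w" if "?S w"
    using that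
  proof (induction w)
    case (Cons a w)
    show ?case
    proof (cases "isl a")
      case True
      then show ?thesis
        using Cons by (cases w) (simp_all add: left_first_def)
    next
      case False
      then show ?thesis
        using successively_joined_Cons_not_isl[of a w] Cons.prems
        by (simp add: left_first_def filter_conv_if_all(3,4))
    qed
  qed (simp add: left_first_def)
  \<comment> \<open>The junction imposes no condition, because it goes from the first kind to the
    second.\<close>
  have "?S (l @ r) \<longleftrightarrow> ?S l \<and> ?S r" if "\<forall>a \<in> set l. isl a" "\<forall>a \<in> set r. \<not> isl a" for l r
    using that joined_isl_cases(1)[of "last l" "hd r"]
    by (cases "l = []"; cases "r = []") (auto simp: successively_append_iff)
  then have app: "?S (filter isl w @ filter (\<lambda>a. \<not> isl a) w) \<longleftrightarrow>
      ?S (filter isl w) \<and> ?S (filter (\<lambda>a. \<not> isl a) w)"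
    by simp
  show ?thesis
  proof (cases "left_first isl w")
    case True
    then show ?thesis
      using app unfolding left_first_def by simp
  next
    case False
    then show ?thesis
      using decomp by blast
  qed
qed

text \<open>The words dropped by \<open>parts\<close> are empty and thus trivially chains, so the
  chain condition can range over all words of \<open>K\<close>.\<close>

lemma parts_in_chain_factorizations_iff:
  "parts p K \<in> chain_factorizations R c \<longleftrightarrow>
     filter p (concat K) = c \<and> (\<forall>w \<in> set K. successively R (filter p w))"
proof -
  have "(\<forall>u \<in> filter p ` set K - {[]}. u \<noteq> [] \<and> successively R u) \<longleftrightarrow>
      (\<forall>w \<in> set K. filter p w \<noteq> [] \<longrightarrow> successively R (filter p w))"
    by blast
  also have "\<dots> \<longleftrightarrow> (\<forall>w \<in> set K. successively R (filter p w))"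
    using successively.simps(1) by metis
  finally show ?thesis
    unfolding chain_factorizations_def mem_Collect_eq concat_parts set_parts by (rule conj_cong[OF refl])
qed

text \<open>The same marked sentences are sorted in two ways: by their concatenation, and by their
  restrictions to the two kinds of letters.\<close>

lemma Union_chain_factorizations_shuffles:
  assumes x: "\<forall>a \<in> set x. isl a" and y: "\<forall>a \<in> set y. \<not> isl a"
  shows "(\<Union>c \<in> shuffles x y. chain_factorizations joined c) =
    (\<Union>(P, Q) \<in> chain_factorizations joined x \<times> chain_factorizations joined y. merges isl P Q)"
proof (rule set_eqI)
  fix K
  have "K \<in> (\<Union>c \<in> shuffles x y. chain_factorizations joined c) \<longleftrightarrow>
      concat K \<in> shuffles x y \<and> (\<forall>w \<in> set K. w \<noteq> [] \<and> successively joined w)"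
    unfolding chain_factorizations_def by blast
  also have "\<dots> \<longleftrightarrow> filter isl (concat K) = x \<and> filter (\<lambda>a. \<not> isl a) (concat K) = y \<and>
      (\<forall>w \<in> set K. w \<noteq> [] \<and> left_first isl w \<and> successively joined (filter isl w) \<and>
        successively joined (filter (\<lambda>a. \<not> isl a) w))"
    unfolding mem_shuffles_iff_filter[OF x y] by (subst successively_joined_iff) (rule conj_assoc)
  also have "\<dots> \<longleftrightarrow> parts isl K \<in> chain_factorizations joined x \<and>
      parts (\<lambda>a. \<not> isl a) K \<in> chain_factorizations joined y \<and>
      (\<forall>w \<in> set K. w \<noteq> [] \<and> left_first isl w)"
    unfolding parts_in_chain_factorizations_iff by blast
  also have "\<dots> \<longleftrightarrow> K \<in> (\<Union>(P, Q) \<in>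
      chain_factorizations joined x \<times> chain_factorizations joined y. merges isl P Q)"
    unfolding merges_def by blast
  finally show "K \<in> (\<Union>c \<in> shuffles x y. chain_factorizations joined c) \<longleftrightarrow>
    K \<in> (\<Union>(P, Q) \<in> chain_factorizations joined x \<times> chain_factorizations joined y. merges isl P Q)" .
qed

text \<open>Both unions are disjoint, as \<open>K\<close> determines its concatenation
  \<open>c\<close> as well as its pair of restrictions \<open>(P, Q)\<close>. Summing over either
  one counts every \<open>K\<close> once.\<close>

lemma sum_chain_factorizations_shuffles:
  fixes h :: "_ \<Rightarrow> 'c::comm_monoid_add"
  assumes x: "\<forall>a \<in> set x. isl a" and y: "\<forall>a \<in> set y. \<not> isl a"
  shows "(\<Sum>c \<in> shuffles x y. \<Sum>K \<in> chain_factorizations joined c. h K) =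
    (\<Sum>P \<in> chain_factorizations joined x. \<Sum>Q \<in> chain_factorizations joined y.
       \<Sum>K \<in># quasi_shuffle P Q. h K)"
proof -
  have qs: "finite (merges isl P Q) \<and> quasi_shuffle P Q = mset_set (merges isl P Q)"
    if "P \<in> chain_factorizations joined x" "Q \<in> chain_factorizations joined y" for P Q
    using that x y by (intro quasi_shuffle_eq_mset_merges) (auto simp: chain_factorizations_def)
  have "(\<Sum>c \<in> shuffles x y. \<Sum>K \<in> chain_factorizations joined c. h K) =
    (\<Sum>K \<in> (\<Union>c \<in> shuffles x y. chain_factorizations joined c). h K)"
    by (rule sum.UNION_disjoint[symmetric])
      (auto simp: finite_chain_factorizations, auto simp: chain_factorizations_def)
  also have "\<dots> = (\<Sum>(P, Q) \<in> chain_factorizations joined x \<times> chain_factorizations joined y.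
      \<Sum>K \<in> merges isl P Q. h K)"
    unfolding Union_chain_factorizations_shuffles[OF x y]
    by (subst sum.UNION_disjoint)
      (auto simp: finite_chain_factorizations qs split_beta, auto simp: merges_def)
  also have "\<dots> = (\<Sum>P \<in> chain_factorizations joined x. \<Sum>Q \<in> chain_factorizations joined y.
      \<Sum>K \<in># quasi_shuffle P Q. h K)"
    unfolding sum.cartesian_product[symmetric]
    by (intro sum.cong refl) (simp add: qs sum_unfold_sum_mset)
  finally show ?thesis .
qed

section \<open>Recovering a sentence from its marked letters, and the product formula\<close>

lemma split_runs_indexed_letters:
  assumes "I \<in> sentences A"
    and "\<And>i a j b. joined (g (i, a)) (g (j, b)) \<longleftrightarrow> i = j" and "\<And>i a. letter (g (i, a)) = a"
  shows "map (map letter) (split_runs joined (map g (indexed_letters I))) = I"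
proof -
  \<comment> \<open>The words of \<open>I\<close> with marks kept; \<open>g\<close> stands for
    \<open>Inl\<close> or \<open>Inr\<close>.\<close>
  let ?Ws = "map (\<lambda>i. map (\<lambda>a. g (i, a)) (I ! i)) [0..<length I]"
  have ne: "I ! i \<noteq> []" if "i < length I" for i
    using assms(1) that by (auto simp: sentences_def)
  have "successively joined (map (\<lambda>a. g (i, a)) u)" for i u
    by (simp add: successively_conv_nth assms(2))
  \<comment> \<open>Neighbouring words carry different indices, and since they are non-empty,
    \<open>last\<close> and \<open>hd\<close> pick actual letters with these indices.\<close>
  moreover have "successively (\<lambda>u v. \<not> joined (last u) (hd v)) ?Ws"
    using ne by (auto simp: successively_conv_nth last_map hd_map assms(2))
  ultimately have "split_runs joined (concat ?Ws) = ?Ws"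
    using ne by (intro split_runs_concat) auto
  moreover have "map g (indexed_letters I) = concat ?Ws"
    by (simp add: indexed_letters_def map_concat comp_def)
  moreover have "map (map letter) ?Ws = I"
    by (rule nth_equalityI) (auto simp: comp_def assms(3))
  ultimately show ?thesis by simp
qed

theorem proposition5p2:
  fixes A :: "'a set" and I J :: "'a sentence"
  assumes "finite A" and "I \<in> sentences A" and "J \<in> sentences A"
  shows "(F I :: 'a sentence \<Rightarrow>\<^sub>0 'k::field_char_0) \<odot> F J = (\<Sum>K \<in># I \<star>\<^sub>F J. F K)"
proof -
  define x :: "((nat \<times> 'a) + (nat \<times> 'a)) list" where "x = map Inl (indexed_letters I)"
  define y :: "((nat \<times> 'a) + (nat \<times> 'a)) list" where "y = map Inr (indexed_letters J)"
  let ?m = "map (map letter) :: ((nat \<times> 'a) + (nat \<times> 'a)) list list \<Rightarrow> 'a sentence"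
  \<comment> \<open>Writing \<open>I\<close> and \<open>J\<close> as unmarked runs makes the
    bijection with chain factorizations available for the two factors too, not only for the
    interleavings.\<close>
  have I: "?m (split_runs joined x) = I"
    unfolding x_def using assms(2) by (rule split_runs_indexed_letters) auto
  have J: "?m (split_runs joined y) = J"
    unfolding y_def using assms(3) by (rule split_runs_indexed_letters) auto
  have "(F I :: 'a sentence \<Rightarrow>\<^sub>0 'k) \<odot> F J =
    (\<Sum>P \<in> chain_factorizations joined x. \<Sum>Q \<in> chain_factorizations joined y.
       \<Sum>K \<in># quasi_shuffle (?m P) (?m Q). M K)"
    unfolding F_mult_F
    using bij_betw_chain_factorizations_refinements[of letter joined x, unfolded I]
      bij_betw_chain_factorizations_refinements[of letter joined y, unfolded J]
    by (simp flip: sum.reindex_bij_betw)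
  \<comment> \<open>The quasi-shuffle only concatenates, so it commutes with forgetting marks; terms
    that become equal stay counted separately in the multiset image.\<close>
  also have "\<dots> = (\<Sum>P \<in> chain_factorizations joined x. \<Sum>Q \<in> chain_factorizations joined y.
       \<Sum>K \<in># quasi_shuffle P Q. M (?m K))"
    by (simp add: quasi_shuffle_map multiset.map_comp comp_def)
  also have "\<dots> = (\<Sum>c \<in> shuffles x y. \<Sum>K \<in> chain_factorizations joined c. M (?m K))"
    by (rule sum_chain_factorizations_shuffles[symmetric]) (auto simp: x_def y_def)
  also have "\<dots> = (\<Sum>c \<in> shuffles x y. F (?m (split_runs joined c)))"
    by (simp add: F_split_runs)
  also have "\<dots> = (\<Sum>K \<in># I \<star>\<^sub>F J. F K)"
    by (simp add: fundamental_shuffle_def interleavings_def sum_unfold_sum_mset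
        multiset.map_comp comp_def flip: x_def y_def)
  finally show ?thesis .
qed

end
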